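(* Let $\mathcal{A}=\{A_0,\dots,A_d\}$ be an association scheme and let $G$ be a graph belonging to $\mathcal{A}$, with discriminant $P$. Let $u,v$ be distinct vertices of $G$ and $\tau$ a positive integer. Then the Grover walk on $G$ exhibits perfect state transfer from $u$ to $v$ at time $\tau$ if and only if there exists $B\in\mathcal{A}$ such that $T_\tau(P)=B$, where $B$ is a permutation matrix of order $2$ with no fixed points (i.e. the matrix of a fixed-point-free involution) and $B_{uv}=1$.
   Context: Grover walk: let $G$ be a finite simple graph without isolated vertices. Its symmetric arc set is $\mathcal{A}(G)=\{(u,v),(v,u):uv\in E(G)\}$; for $a=(u,v)$, $t(a)=v$, $a^{-1}=(v,u)$. Shift matrix $S_{ab}=\delta_{a,b^{-1}}$ ($a,b\in\mathcal{A}(G)$); boundary matrix $N\in\mathbb{C}^{V(G)\times\mathcal{A}(G)}$, $N_{ua}=\frac{1}{\sqrt{\deg u}}\delta_{u,t(a)}$; coin $K=2N^*N-I$; time evolution matrix $U=SK$; discriminant $P=NSN^*$. For a vertex $u$ let $\mathbf{e}_u$ be the standard unit vector and $\Phi_u=N^*\mathbf{e}_u$. $G$ exhibits perfect state transfer from $u$ to a vertex $v\neq u$ at time $\tau\in\mathbb{N}$ if $U^\tau\Phi_u=\gamma\Phi_v$ for some $\gamma\in\mathbb{C}$ with $|\gamma|=1$. $T_m$ denotes the Chebyshev polynomial of the first kind: $T_0=1$, $T_1=x$, $T_m=2xT_{m-1}-T_{m-2}$. Association scheme with $d$ classes: a set $\mathcal{A}=\{A_0,\dots,A_d\}$ of $n\times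 n$ $(0,1)$-matrices with $A_0=I$, $\sum_i A_i=J$ (all-ones matrix), each $A_i$ symmetric, and each product $A_iA_j$ a linear combination of $A_0,\dots,A_d$. Its Bose–Mesner algebra $\mathbb{C}[\mathcal{A}]$ is the span of $A_0,\dots,A_d$. A graph (on the $n$ indices) belongs to $\mathcal{A}$ if its adjacency matrix lies in $\mathbb{C}[\mathcal{A}]$. *)

theory Defs
  imports "HOL-Analysis.Analysis" "HOL-Computational_Algebra.Polynomial"
    "HOL-Combinatorics.Permutations"
begin

section \<open>Complex matrices\<close>

text \<open>Products of matrices are \<open>**\<close>. The type-class operations \<open>*\<close> and \<open>^\<close> on
  \<^typ>\<open>complex^'n^'n\<close> act entrywise and are never meant here.\<close>

definition cscale :: "complex \<Rightarrow> complex^'n^'m \<Rightarrow> complex^'n^'m" where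
  "cscale c M = (\<chi> i j. c * M $ i $ j)"

definition adjoint_mat :: "complex^'n^'m \<Rightarrow> complex^'m^'n" where
  "adjoint_mat M = (\<chi> i j. cnj (M $ j $ i))"

fun mat_power :: "complex^'n^'n \<Rightarrow> nat \<Rightarrow> complex^'n^'n" where
  "mat_power M 0 = mat 1"
| "mat_power M (Suc k) = M ** mat_power M k"

definition poly_mat :: "complex poly \<Rightarrow> complex^'n^'n \<Rightarrow> complex^'n^'n" where
  "poly_mat p M = (\<Sum>k\<le>degree p. cscale (coeff p k) (mat_power M k))"

fun cheb_T :: "nat \<Rightarrow> complex poly" where
  "cheb_T 0 = 1"
| "cheb_T (Suc 0) = [:0, 1:]"
| "cheb_T (Suc (Suc m)) = [:0, 2:] * cheb_T (Suc m) - cheb_T m"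

definition permutation_matrix :: "complex^'n^'n \<Rightarrow> bool" where
  "permutation_matrix B \<longleftrightarrow>
     (\<exists>p. p permutes UNIV \<and> B = (\<chi> i j. if i = p j then 1 else 0))"

text \<open>A permutation fixes \<open>x\<close> exactly if its matrix has the diagonal entry 1 at \<open>x\<close>.\<close>

definition fixed_point_free_involution_matrix :: "complex^'n^'n \<Rightarrow> bool" where
  "fixed_point_free_involution_matrix B \<longleftrightarrow>
     permutation_matrix B \<and> B \<noteq> mat 1 \<and> B ** B = mat 1 \<and> (\<forall>x. B $ x $ x \<noteq> 1)"

section \<open>Graphs on a finite vertex type\<close>

definition simple_graph :: "'v::finite set set \<Rightarrow> bool" where
  "simple_graph E \<longleftrightarrow> (\<forall>e\<in>E. card e = 2)"

definition no_isolated_vertices :: "'v::finite set set \<Rightarrow> bool" where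
  "no_isolated_vertices E \<longleftrightarrow> (\<forall>u. \<exists>v. {u, v} \<in> E)"

definition vertex_degree :: "'v::finite set set \<Rightarrow> 'v \<Rightarrow> nat" where
  "vertex_degree E u = card {v. {u, v} \<in> E}"

definition adjacency_matrix :: "'v::finite set set \<Rightarrow> complex^'v^'v" where
  "adjacency_matrix E = (\<chi> u v. if {u, v} \<in> E then 1 else 0)"

definition sym_arcs :: "'v::finite set set \<Rightarrow> ('v \<times> 'v) set" where
  "sym_arcs E = {(u, v). {u, v} \<in> E}"

section \<open>The Grover walk\<close>

text \<open>The arcs of a graph form a set, not a type. A matrix with rows or columns indexed by
  \<^term>\<open>sym_arcs E\<close> is therefore stored over the index type \<^typ>\<open>'v \<times> 'v\<close>, with all entries
  outside the arcs equal to zero; in particular the identity matrix on the arcs is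
  \<open>arc_identity\<close>, not \<open>mat 1\<close>. Sums, products and adjoints of such zero-extended matrices
  are the zero extensions of the sums, products and adjoints.\<close>

definition arc_identity :: "'v::finite set set \<Rightarrow> complex^('v \<times> 'v)^('v \<times> 'v)" where
  "arc_identity E = (\<chi> a b. if a \<in> sym_arcs E \<and> a = b then 1 else 0)"

definition shift_matrix :: "'v::finite set set \<Rightarrow> complex^('v \<times> 'v)^('v \<times> 'v)" where
  "shift_matrix E =
     (\<chi> a b. if a \<in> sym_arcs E \<and> b \<in> sym_arcs E \<and> a = prod.swap b then 1 else 0)"

definition boundary_matrix :: "'v::finite set set \<Rightarrow> complex^('v \<times> 'v)^'v" where
  "boundary_matrix E =
     (\<chi> u a. if a \<in> sym_arcs E \<and> u = snd a
             then complex_of_real (1 / sqrt (real (vertex_degree E u))) else 0)"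

definition coin_matrix :: "'v::finite set set \<Rightarrow> complex^('v \<times> 'v)^('v \<times> 'v)" where
  "coin_matrix E =
     cscale 2 (adjoint_mat (boundary_matrix E) ** boundary_matrix E) - arc_identity E"

definition time_evolution :: "'v::finite set set \<Rightarrow> complex^('v \<times> 'v)^('v \<times> 'v)" where
  "time_evolution E = shift_matrix E ** coin_matrix E"

definition discriminant :: "'v::finite set set \<Rightarrow> complex^'v^'v" where
  "discriminant E = boundary_matrix E ** shift_matrix E ** adjoint_mat (boundary_matrix E)"

definition vertex_state :: "'v::finite set set \<Rightarrow> 'v \<Rightarrow> complex^('v \<times> 'v)" where
  "vertex_state E u = adjoint_mat (boundary_matrix E) *v axis u 1"

text \<open>The zeroth power of \<^term>\<open>time_evolution E\<close> is the identity on the whole index type, but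
  it agrees with \<^term>\<open>arc_identity E\<close> on the vertex states, which vanish outside the arcs.\<close>

definition perfect_state_transfer :: "'v::finite set set \<Rightarrow> 'v \<Rightarrow> 'v \<Rightarrow> nat \<Rightarrow> bool" where
  "perfect_state_transfer E u v \<tau> \<longleftrightarrow>
     u \<noteq> v \<and>
     (\<exists>\<gamma>. cmod \<gamma> = 1 \<and>
       mat_power (time_evolution E) \<tau> *v vertex_state E u = \<gamma> *s vertex_state E v)"

section \<open>Association schemes\<close>

text \<open>The complex span; the library's \<^const>\<open>span\<close> on this type is the real one.\<close>

definition bose_mesner :: "nat \<Rightarrow> (nat \<Rightarrow> complex^'n^'n) \<Rightarrow> (complex^'n^'n) set" where
  "bose_mesner d A = {\<Sum>i\<le>d. cscale (c i) (A i) | c. True}"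

definition association_scheme :: "nat \<Rightarrow> (nat \<Rightarrow> complex^'n^'n) \<Rightarrow> bool" where
  "association_scheme d A \<longleftrightarrow>
     (\<forall>i\<le>d. \<forall>x y. A i $ x $ y \<in> {0, 1}) \<and>
     A 0 = mat 1 \<and>
     (\<Sum>i\<le>d. A i) = (\<chi> x y. 1) \<and>
     (\<forall>i\<le>d. transpose (A i) = A i) \<and>
     (\<forall>i\<le>d. \<forall>j\<le>d. A i ** A j \<in> bose_mesner d A)"

definition belongs_to_scheme ::
    "'v::finite set set \<Rightarrow> nat \<Rightarrow> (nat \<Rightarrow> complex^'v^'v) \<Rightarrow> bool" where
  "belongs_to_scheme E d A \<longleftrightarrow> adjacency_matrix E \<in> bose_mesner d A"

end

(* Writing N, S, U, P as in the text, U N* = S N* and S S = I on the arcs give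
   U U N* = 2 U N* P - N*, so N U^m N* obeys the Chebyshev recurrence and equals T_m(P).

   If the walk transfers u to v, column u of T_tau(P) is gamma e_v. A graph in the scheme is
   regular, so T_tau(P) lies in the Bose-Mesner algebra. Each nonzero class meets column u, hence
   T_tau(P) = gamma A_j for one class A_j of valency 1, and gamma = 1 because P, and so T_tau(P),
   has row sums 1.

   Conversely, if T_tau(P) = B is unitary, then with Z = U^tau N* both Z* Z = I and N Z = B, so
   W = Z - N* B satisfies W* W = 0 and Z = N* B. *)

theory Submission
  imports Defs
begin

section \<open>Matrices\<close>

lemma cscale_nth [simp]: "cscale c M $ i $ j = c * M $ i $ j"
  by (simp add: cscale_def)

lemma adjoint_mat_nth [simp]: "adjoint_mat M $ i $ j = cnj (M $ j $ i)"
  by (simp add: adjoint_mat_def)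

lemma matrix_mult_nth: "(M ** N) $ i $ j = (\<Sum>k\<in>UNIV. M $ i $ k * N $ k $ j)"
  by (simp add: matrix_matrix_mult_def)

lemma mat_nth: "mat c $ i $ j = (if i = j then c else 0)"
  by (simp add: mat_def)

lemma adjoint_mat_mult: "adjoint_mat (M ** N) = adjoint_mat N ** adjoint_mat M"
  by (simp add: vec_eq_iff matrix_mult_nth mult.commute)

lemma adjoint_mat_diff: "adjoint_mat (M - N) = adjoint_mat M - adjoint_mat N"
  by (simp add: vec_eq_iff)

lemma adjoint_mat_cscale: "adjoint_mat (cscale c M) = cscale (cnj c) (adjoint_mat M)"
  by (simp add: vec_eq_iff)

lemma adjoint_mat_adjoint_mat [simp]: "adjoint_mat (adjoint_mat M) = M"
  by (simp add: vec_eq_iff)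

lemma matrix_diff_ldistrib: "M ** (N - L) = M ** N - M ** (L :: complex^'n^'m)"
  by (simp add: vec_eq_iff matrix_mult_nth algebra_simps sum_subtractf)

lemma matrix_diff_rdistrib: "(M - N) ** L = M ** L - N ** (L :: complex^'n^'m)"
  by (simp add: vec_eq_iff matrix_mult_nth algebra_simps sum_subtractf)

lemma cscale_mult_left: "cscale c M ** N = cscale c (M ** N)"
  by (simp add: vec_eq_iff matrix_mult_nth sum_distrib_left mult.assoc)

lemma cscale_mult_right: "M ** cscale c N = cscale c (M ** N)"
  by (simp add: vec_eq_iff matrix_mult_nth sum_distrib_left mult_ac)

lemma matrix_mult_sum_left: "(\<Sum>i\<in>I. M i) ** N = (\<Sum>i\<in>I. M i ** (N :: complex^'n^'m))"
  by (induction I rule: infinite_finite_induct)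
     (simp_all add: vec_eq_iff matrix_mult_nth algebra_simps sum.distrib)

lemma matrix_mult_sum_right: "N ** (\<Sum>i\<in>I. M i) = (\<Sum>i\<in>I. N ** (M i :: complex^'n^'m))"
  by (induction I rule: infinite_finite_induct)
     (simp_all add: vec_eq_iff matrix_mult_nth algebra_simps sum.distrib)

lemma matrix_mult_axis: "M *v axis j 1 = column j (M :: complex^'n^'m)"
  by (simp add: vec_eq_iff matrix_vector_mult_def column_def axis_def if_distrib cong: if_cong)

text \<open>The diagonal entry of M* M at j is the sum of the squared moduli in column j of M; if it
  vanishes, so does every entry of that column.\<close>

lemma adjoint_mult_self_eq_0:
  fixes M :: "complex^'n^'m"
  assumes "adjoint_mat M ** M = 0"
  shows "M = 0"
proof -
  have "M $ i $ j = 0" for i j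
  proof -
    have "of_real (\<Sum>k\<in>UNIV. (cmod (M $ k $ j))\<^sup>2) = (adjoint_mat M ** M) $ j $ j"
      unfolding matrix_mult_nth of_real_sum
      by (rule sum.cong) (simp_all only: complex_norm_square adjoint_mat_nth mult.commute)
    hence "(\<Sum>k\<in>UNIV. (cmod (M $ k $ j))\<^sup>2) = 0"
      using assms of_real_eq_0_iff by (metis zero_index)
    thus ?thesis
      by (simp add: sum_nonneg_eq_0_iff)
  qed
  thus ?thesis
    by (simp add: vec_eq_iff)
qed

section \<open>Polynomials evaluated at a matrix, and the Chebyshev recurrence\<close>

lemma mat_power_Suc_right: "mat_power M (Suc k) = mat_power M k ** M"
proof (induction k)
  case (Suc k)
  thus ?case by (metis mat_power.simps(2) matrix_mul_assoc)
qed simp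

text \<open>Padding with zero coefficients brings polynomials of different degrees to a common
  summation range, which is what makes linearity provable termwise.\<close>

lemma poly_mat_atMost:
  "degree p \<le> n \<Longrightarrow> poly_mat p M = (\<Sum>k\<le>n. cscale (coeff p k) (mat_power M k))"
  unfolding poly_mat_def
  by (rule sum.mono_neutral_left) (auto simp: coeff_eq_0 vec_eq_iff)

lemma poly_mat_1: "poly_mat 1 M = mat 1"
  by (simp add: poly_mat_def vec_eq_iff)

lemma poly_mat_diff: "poly_mat (p - q) M = poly_mat p M - poly_mat q M"
proof -
  let ?n = "max (degree p) (degree q)"
  have "degree (p - q) \<le> ?n"
    by (rule degree_diff_le_max)
  thus ?thesis
    by (simp add: poly_mat_atMost[of _ ?n] vec_eq_iff sum_subtractf algebra_simps)
qed

lemma poly_mat_smult: "poly_mat (smult c p) M = cscale c (poly_mat p M)"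
  using poly_mat_atMost[of "smult c p" "degree p" M]
  by (simp add: poly_mat_def[of p] vec_eq_iff sum_distrib_left mult.assoc)

lemma poly_mat_pCons_0: "poly_mat (pCons 0 p) M = poly_mat p M ** M"
proof -
  have "poly_mat (pCons 0 p) M
      = (\<Sum>k\<le>Suc (degree p). cscale (coeff (pCons 0 p) k) (mat_power M k))"
    by (rule poly_mat_atMost) (rule degree_pCons_le)
  \<comment> \<open>The constant term vanishes, and the shifted powers release their extra factor
    \<open>M\<close> on the right, the side where the walk recurrence produces the
    discriminant.\<close>
  also have "\<dots> = (\<Sum>k\<le>degree p. cscale (coeff p k) (mat_power M k) ** M)"
    by (subst sum.atMost_Suc_shift)
       (simp add: cscale_mult_left vec_eq_iff del: mat_power.simps(2) add: mat_power_Suc_right)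
  finally show ?thesis
    by (simp add: poly_mat_def matrix_mult_sum_left)
qed

lemma poly_mat_cheb_T_0: "poly_mat (cheb_T 0) M = mat 1"
  by (simp add: poly_mat_1)

lemma poly_mat_cheb_T_1: "poly_mat (cheb_T (Suc 0)) M = M"
  using poly_mat_pCons_0[of 1 M] poly_mat_1[of M] by (simp add: one_pCons)

lemma poly_mat_cheb_T_Suc_Suc:
  "poly_mat (cheb_T (Suc (Suc m))) M
     = cscale 2 (poly_mat (cheb_T (Suc m)) M ** M) - poly_mat (cheb_T m) M"
  by (simp add: poly_mat_diff poly_mat_smult poly_mat_pCons_0 cscale_mult_left)

text \<open>The all-ones vector is fixed by \<open>M\<close>, and the recurrence preserves this
  because 2 * 1 - 1 = 1; in other words T_m(1) = 1. This later pins down the phase of a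
  transfer.\<close>

lemma cheb_T_row_sum:
  assumes "\<And>x. (\<Sum>y\<in>UNIV. M $ x $ y) = 1"
  shows "(\<Sum>y\<in>UNIV. poly_mat (cheb_T m) M $ x $ y) = 1"
proof (induction m rule: cheb_T.induct)
  case 1
  show ?case by (simp add: poly_mat_1 mat_nth)
next
  case 2
  show ?case by (simp only: poly_mat_cheb_T_1 assms)
next
  case (3 m)
  let ?T = "poly_mat (cheb_T (Suc m)) M"
  have "(\<Sum>y\<in>UNIV. (?T ** M) $ x $ y) = (\<Sum>k\<in>UNIV. ?T $ x $ k * (\<Sum>y\<in>UNIV. M $ k $ y))"
    unfolding matrix_mult_nth sum_distrib_left by (rule sum.swap)
  also have "\<dots> = 1"
    by (simp add: assms "3.IH"(1))
  finally show ?case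
    by (simp only: poly_mat_cheb_T_Suc_Suc vector_minus_component cscale_nth sum_subtractf
        "3.IH"(2) flip: sum_distrib_left) simp
qed

section \<open>The Grover walk\<close>

lemma swap_mem_sym_arcs [simp]: "prod.swap a \<in> sym_arcs E \<longleftrightarrow> a \<in> sym_arcs E"
  by (cases a) (simp add: sym_arcs_def insert_commute)

lemma vertex_degree_pos: "no_isolated_vertices E \<Longrightarrow> 0 < vertex_degree E u"
  unfolding no_isolated_vertices_def vertex_degree_def by (simp add: card_gt_0_iff)

section \<open>Products of the shift, the arc identity and the boundary matrix\<close>

lemma shift_mult_shift: "shift_matrix E ** shift_matrix E = arc_identity E"
proof -
  have "(shift_matrix E ** shift_matrix E) $ a $ b = arc_identity E $ a $ b" for a b
  proof -
    have "(shift_matrix E ** shift_matrix E) $ a $ b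
        = (\<Sum>c\<in>UNIV. if c = prod.swap b then (if a \<in> sym_arcs E \<and> a = b then 1 else 0) else 0)"
      unfolding matrix_mult_nth by (rule sum.cong) (auto simp: shift_matrix_def)
    thus ?thesis by (simp add: arc_identity_def)
  qed
  thus ?thesis by (simp add: vec_eq_iff)
qed

lemma adjoint_shift: "adjoint_mat (shift_matrix E) = shift_matrix E"
  by (auto simp: vec_eq_iff shift_matrix_def)

lemma adjoint_arc_identity: "adjoint_mat (arc_identity E) = arc_identity E"
  by (auto simp: vec_eq_iff arc_identity_def)

text \<open>Left multiplication erases the rows outside the arcs, so it fixes exactly the matrices
  whose rows are supported on arcs.\<close>

lemma arc_identity_mult:
  fixes M :: "complex^'n^('v::finite \<times> 'v)"
  shows "arc_identity E ** M = (\<chi> a j. if a \<in> sym_arcs E then M $ a $ j else 0)"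
proof -
  have "(arc_identity E ** M) $ a $ j = (if a \<in> sym_arcs E then M $ a $ j else 0)" for a j
  proof -
    have "(arc_identity E ** M) $ a $ j
        = (\<Sum>c\<in>UNIV. if c = a then (if a \<in> sym_arcs E then M $ a $ j else 0) else 0)"
      unfolding matrix_mult_nth by (rule sum.cong) (auto simp: arc_identity_def)
    thus ?thesis by simp
  qed
  thus ?thesis by (simp add: vec_eq_iff)
qed

lemma arc_identity_mult_shift: "arc_identity E ** shift_matrix E = shift_matrix E"
  by (auto simp: arc_identity_mult vec_eq_iff shift_matrix_def)

lemma arc_identity_mult_arc_identity: "arc_identity E ** arc_identity E = arc_identity E"
  unfolding arc_identity_mult by (auto simp: vec_eq_iff arc_identity_def)

lemma arc_identity_mult_adjoint_boundary:
  "arc_identity E ** adjoint_mat (boundary_matrix E) = adjoint_mat (boundary_matrix E)"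
  by (auto simp: arc_identity_mult vec_eq_iff boundary_matrix_def)

lemma boundary_mult_arc_identity: "boundary_matrix E ** arc_identity E = boundary_matrix E"
  using arg_cong[OF arc_identity_mult_adjoint_boundary, of adjoint_mat]
  by (simp add: adjoint_mat_mult adjoint_arc_identity)

text \<open>An arc has one head, so distinct rows have disjoint supports; the deg u arcs into u
  contribute 1 / deg u each, and deg u is nonzero without isolated vertices.\<close>

lemma boundary_mult_adjoint:
  assumes "no_isolated_vertices E"
  shows "boundary_matrix E ** adjoint_mat (boundary_matrix E) = mat 1"
proof -
  have "(boundary_matrix E ** adjoint_mat (boundary_matrix E)) $ u $ v = mat 1 $ u $ v" for u v
  proof -
    let ?r = "if u = v then complex_of_real (1 / real (vertex_degree E u)) else 0"
    have arcs: "{a. a \<in> sym_arcs E \<and> snd a = u} = (\<lambda>w. (w, u)) ` {w. {u, w} \<in> E}"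
      by (auto simp: sym_arcs_def insert_commute)
    have "(boundary_matrix E ** adjoint_mat (boundary_matrix E)) $ u $ v
        = (\<Sum>a\<in>UNIV. if a \<in> sym_arcs E \<and> snd a = u then ?r else 0)"
      unfolding matrix_mult_nth
      by (rule sum.cong) (auto simp: boundary_matrix_def simp flip: of_real_mult of_real_divide)
    also have "\<dots> = (\<Sum>a | a \<in> sym_arcs E \<and> snd a = u. ?r)"
      by (subst sum.inter_filter[symmetric]) simp_all
    also have "\<dots> = of_nat (vertex_degree E u) * ?r"
      unfolding arcs by (simp add: card_image inj_on_def vertex_degree_def)
    finally show ?thesis
      using vertex_degree_pos[OF assms, of u] by (auto simp: mat_nth)
  qed
  thus ?thesis by (simp add: vec_eq_iff)
qed

lemma discriminant_nth:
  "discriminant E $ u $ v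
     = adjacency_matrix E $ u $ v
       / complex_of_real (sqrt (real (vertex_degree E u)) * sqrt (real (vertex_degree E v)))"
proof -
  let ?N = "boundary_matrix E"
  have SN: "(shift_matrix E ** adjoint_mat ?N) $ a $ v = ?N $ v $ prod.swap a" for a
  proof -
    have "(shift_matrix E ** adjoint_mat ?N) $ a $ v
        = (\<Sum>c\<in>UNIV. if c = prod.swap a then ?N $ v $ prod.swap a else 0)"
      unfolding matrix_mult_nth
      by (rule sum.cong) (auto simp: shift_matrix_def boundary_matrix_def)
    thus ?thesis by simp
  qed
  have "discriminant E $ u $ v = (\<Sum>a\<in>UNIV. ?N $ u $ a * ?N $ v $ prod.swap a)"
    unfolding discriminant_def matrix_mul_assoc[symmetric]
    by (subst matrix_mult_nth) (simp add: SN)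
  \<comment> \<open>A nonzero summand needs an arc with head u whose inverse has head v, which
    leaves only (v, u).\<close>
  also have "\<dots> = (\<Sum>a\<in>UNIV. if a = (v, u) then ?N $ u $ (v, u) * ?N $ v $ (u, v) else 0)"
    by (rule sum.cong) (auto simp: boundary_matrix_def sym_arcs_def insert_commute)
  finally show ?thesis
    by (simp add: boundary_matrix_def adjacency_matrix_def sym_arcs_def insert_commute)
qed

section \<open>Powers of the time evolution applied to N*\<close>

lemma time_evolution_adjoint_boundary:
  assumes "no_isolated_vertices E"
  shows "time_evolution E ** adjoint_mat (boundary_matrix E)
    = shift_matrix E ** adjoint_mat (boundary_matrix E)"
proof -
  let ?M = "adjoint_mat (boundary_matrix E)"
  \<comment> \<open>Since N N* = I, the coin fixes every column of N*.\<close>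
  have "coin_matrix E ** ?M = cscale 2 ?M - ?M"
    by (simp add: coin_matrix_def matrix_diff_rdistrib cscale_mult_left
        boundary_mult_adjoint[OF assms] arc_identity_mult_adjoint_boundary
        flip: matrix_mul_assoc)
  also have "\<dots> = ?M"
    by (simp add: vec_eq_iff)
  finally show ?thesis
    by (simp add: time_evolution_def flip: matrix_mul_assoc)
qed

lemma time_evolution_twice_adjoint_boundary:
  assumes "no_isolated_vertices E"
  shows "time_evolution E ** (time_evolution E ** adjoint_mat (boundary_matrix E))
    = cscale 2 (time_evolution E ** adjoint_mat (boundary_matrix E) ** discriminant E)
      - adjoint_mat (boundary_matrix E)"
proof -
  let ?N = "boundary_matrix E" and ?M = "adjoint_mat (boundary_matrix E)" and ?S = "shift_matrix E"
  \<comment> \<open>The coin produces N* N S N*, whose last three factors are the discriminant; the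
    outer shift then cancels the inner one in the remaining term.\<close>
  have "coin_matrix E ** (?S ** ?M) = cscale 2 (?M ** discriminant E) - ?S ** ?M"
    by (simp add: coin_matrix_def matrix_diff_rdistrib cscale_mult_left discriminant_def
        matrix_mul_assoc arc_identity_mult_shift)
  hence "time_evolution E ** (?S ** ?M)
      = cscale 2 (?S ** ?M ** discriminant E) - ?S ** ?S ** ?M"
    by (simp add: time_evolution_def matrix_diff_ldistrib cscale_mult_right
        flip: matrix_mul_assoc)
  thus ?thesis
    by (simp add: time_evolution_adjoint_boundary[OF assms] shift_mult_shift
        arc_identity_mult_adjoint_boundary)
qed

lemma boundary_time_evolution_power:
  assumes "no_isolated_vertices E"
  shows "boundary_matrix E ** (mat_power (time_evolution E) m ** adjoint_mat (boundary_matrix E))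
    = poly_mat (cheb_T m) (discriminant E)"
proof (induction m rule: cheb_T.induct)
  case 1
  show ?case by (simp add: boundary_mult_adjoint[OF assms] poly_mat_1)
next
  case 2
  show ?case
    unfolding poly_mat_cheb_T_1
    by (simp add: time_evolution_adjoint_boundary[OF assms] discriminant_def matrix_mul_assoc)
next
  case (3 m)
  let ?U = "time_evolution E" and ?N = "boundary_matrix E" and ?M = "adjoint_mat (boundary_matrix E)"
  \<comment> \<open>Factors are split off on the right, so that the two innermost ones act on N* and
    the two-step identity applies.\<close>
  have "mat_power ?U (Suc (Suc m)) ** ?M = mat_power ?U m ** (?U ** (?U ** ?M))"
    by (simp only: mat_power_Suc_right matrix_mul_assoc)
  also have "\<dots> = mat_power ?U m ** (cscale 2 (?U ** ?M ** discriminant E) - ?M)"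
    by (simp only: time_evolution_twice_adjoint_boundary[OF assms])
  also have "\<dots> = cscale 2 (mat_power ?U (Suc m) ** ?M ** discriminant E) - mat_power ?U m ** ?M"
    by (simp only: matrix_diff_ldistrib cscale_mult_right mat_power_Suc_right matrix_mul_assoc)
  finally have "?N ** (mat_power ?U (Suc (Suc m)) ** ?M)
      = cscale 2 (?N ** (mat_power ?U (Suc m) ** ?M) ** discriminant E)
        - ?N ** (mat_power ?U m ** ?M)"
    by (simp only: matrix_diff_ldistrib cscale_mult_right matrix_mul_assoc)
  thus ?case
    by (simp only: "3.IH" poly_mat_cheb_T_Suc_Suc)
qed

text \<open>With Q = N* N, the relation N N* = I makes Q a projection, so the coin 2 Q - I is a
  self-adjoint reflection on the arcs; the shift is a self-adjoint involution there. Zero extension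
  turns the identity into \<open>arc_identity E\<close>.\<close>

lemma adjoint_time_evolution_mult:
  assumes "no_isolated_vertices E"
  shows "adjoint_mat (time_evolution E) ** time_evolution E = arc_identity E"
proof -
  let ?K = "coin_matrix E" and ?Q = "adjoint_mat (boundary_matrix E) ** boundary_matrix E"
  let ?I = "arc_identity E"
  have K: "adjoint_mat ?K = ?K"
    by (simp add: coin_matrix_def adjoint_mat_diff adjoint_mat_cscale adjoint_mat_mult
        adjoint_arc_identity)
  have IQ: "?I ** ?Q = ?Q"
    by (simp add: matrix_mul_assoc arc_identity_mult_adjoint_boundary)
  have QI: "?Q ** ?I = ?Q"
    by (simp add: boundary_mult_arc_identity flip: matrix_mul_assoc)
  have "?Q ** ?Q = adjoint_mat (boundary_matrix E)
      ** (boundary_matrix E ** adjoint_mat (boundary_matrix E)) ** boundary_matrix E"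
    by (simp only: matrix_mul_assoc)
  hence QQ: "?Q ** ?Q = ?Q"
    by (simp add: boundary_mult_adjoint[OF assms])
  have IK: "?I ** ?K = ?K"
    by (simp add: coin_matrix_def matrix_diff_ldistrib cscale_mult_right IQ
        arc_identity_mult_arc_identity)
  have "adjoint_mat (time_evolution E) ** time_evolution E
      = ?K ** (shift_matrix E ** shift_matrix E ** ?K)"
    by (simp add: time_evolution_def adjoint_mat_mult K adjoint_shift matrix_mul_assoc)
  also have "\<dots> = ?K ** ?K"
    by (simp add: shift_mult_shift IK)
  also have "\<dots> = ?I"
    by (simp add: coin_matrix_def matrix_diff_ldistrib matrix_diff_rdistrib cscale_mult_right
        cscale_mult_left IQ QI QQ arc_identity_mult_arc_identity)
       (simp add: vec_eq_iff)
  finally show ?thesis .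
qed

lemma time_evolution_power_isometry:
  assumes "no_isolated_vertices E"
  shows "adjoint_mat (mat_power (time_evolution E) m ** adjoint_mat (boundary_matrix E))
      ** (mat_power (time_evolution E) m ** adjoint_mat (boundary_matrix E)) = mat 1"
proof (induction m)
  case 0
  show ?case by (simp add: boundary_mult_adjoint[OF assms])
next
  case (Suc m)
  let ?U = "time_evolution E"
  let ?Z = "mat_power ?U m ** adjoint_mat (boundary_matrix E)"
  \<comment> \<open>U* U is the identity only on arcs, so \<open>?Z\<close> must be supported there:
    for m = 0 it is N*, otherwise its leftmost factor is the shift.\<close>
  have "arc_identity E ** ?Z = ?Z"
  proof (cases m)
    case (Suc k)
    thus ?thesis
      by (simp add: time_evolution_def matrix_mul_assoc arc_identity_mult_shift)
  qed (simp add: arc_identity_mult_adjoint_boundary)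
  moreover have "adjoint_mat (?U ** ?Z) ** (?U ** ?Z)
      = adjoint_mat ?Z ** (adjoint_mat ?U ** ?U ** ?Z)"
    by (simp only: adjoint_mat_mult matrix_mul_assoc)
  ultimately have "adjoint_mat (?U ** ?Z) ** (?U ** ?Z) = adjoint_mat ?Z ** ?Z"
    by (simp only: adjoint_time_evolution_mult[OF assms])
  thus ?case
    using Suc by (simp flip: matrix_mul_assoc)
qed

lemma time_evolution_power_eq_if_cheb_T:
  assumes "no_isolated_vertices E"
    and "poly_mat (cheb_T m) (discriminant E) = B"
    and "adjoint_mat B ** B = mat 1"
  shows "mat_power (time_evolution E) m ** adjoint_mat (boundary_matrix E)
    = adjoint_mat (boundary_matrix E) ** B"
proof -
  let ?N = "boundary_matrix E"
  define Z where "Z = mat_power (time_evolution E) m ** adjoint_mat ?N"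
  have NZ: "?N ** Z = B"
    using boundary_time_evolution_power[OF assms(1), of m] assms(2) by (simp add: Z_def)
  have ZN: "adjoint_mat Z ** adjoint_mat ?N = adjoint_mat B"
    by (simp flip: NZ adjoint_mat_mult)
  have ZZ: "adjoint_mat Z ** Z = mat 1"
    using time_evolution_power_isometry[OF assms(1)] by (simp add: Z_def)
  have ZNB: "adjoint_mat Z ** (adjoint_mat ?N ** B) = mat 1"
    by (simp add: matrix_mul_assoc ZN assms(3))
  have BNZ: "adjoint_mat B ** ?N ** Z = mat 1"
    by (simp add: NZ assms(3) flip: matrix_mul_assoc)
  have "adjoint_mat B ** ?N ** (adjoint_mat ?N ** B)
      = adjoint_mat B ** (?N ** adjoint_mat ?N) ** B"
    by (simp only: matrix_mul_assoc)
  hence BNNB: "adjoint_mat B ** ?N ** (adjoint_mat ?N ** B) = mat 1"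
    by (simp add: boundary_mult_adjoint[OF assms(1)] assms(3))
  \<comment> \<open>All four products in the expansion equal the identity, two with each sign.
    Geometrically, N loses no norm on the columns of \<open>Z\<close>, so they lie in the range of
    N*.\<close>
  have "adjoint_mat (Z - adjoint_mat ?N ** B) ** (Z - adjoint_mat ?N ** B) = 0"
    by (simp add: adjoint_mat_diff adjoint_mat_mult matrix_diff_ldistrib matrix_diff_rdistrib
        ZZ ZNB BNZ BNNB)
  hence "Z - adjoint_mat ?N ** B = 0"
    by (rule adjoint_mult_self_eq_0)
  thus ?thesis
    by (simp add: Z_def)
qed

section \<open>Association schemes\<close>

lemma bose_mesnerI: "(\<Sum>i\<le>d. cscale (c i) (A i)) \<in> bose_mesner d A"
  by (auto simp: bose_mesner_def)

lemma bose_mesner_cscale: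
  assumes "M \<in> bose_mesner d A"
  shows "cscale a M \<in> bose_mesner d A"
proof -
  obtain c where "M = (\<Sum>i\<le>d. cscale (c i) (A i))"
    using assms by (auto simp: bose_mesner_def)
  hence "cscale a M = (\<Sum>i\<le>d. cscale (a * c i) (A i))"
    by (simp add: vec_eq_iff sum_distrib_left mult.assoc)
  thus ?thesis by (simp add: bose_mesnerI)
qed

lemma bose_mesner_add:
  assumes "M \<in> bose_mesner d A" "N \<in> bose_mesner d A"
  shows "M + N \<in> bose_mesner d A"
proof -
  obtain c e where "M = (\<Sum>i\<le>d. cscale (c i) (A i))" "N = (\<Sum>i\<le>d. cscale (e i) (A i))"
    using assms by (auto simp: bose_mesner_def)
  hence "M + N = (\<Sum>i\<le>d. cscale (c i + e i) (A i))"
    by (simp add: vec_eq_iff sum.distrib algebra_simps)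
  thus ?thesis by (simp add: bose_mesnerI)
qed

lemma bose_mesner_diff:
  assumes "M \<in> bose_mesner d A" "N \<in> bose_mesner d A"
  shows "M - N \<in> bose_mesner d A"
proof -
  have "M - N = M + cscale (- 1) N"
    by (simp add: vec_eq_iff)
  thus ?thesis
    using assms by (metis bose_mesner_add bose_mesner_cscale)
qed

lemma bose_mesner_sum:
  "(\<And>i. i \<in> I \<Longrightarrow> M i \<in> bose_mesner d A) \<Longrightarrow> (\<Sum>i\<in>I. M i) \<in> bose_mesner d A"
proof (induction I rule: infinite_finite_induct)
  case (insert x I)
  thus ?case by (simp add: bose_mesner_add)
\<comment> \<open>Empty and infinite index sets give the zero matrix, the combination with all
  coefficients 0.\<close>
qed (use bose_mesnerI[of "\<lambda>_. 0" A d] in \<open>simp_all add: cscale_def flip: zero_vec_def\<close>)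

lemma bose_mesner_class:
  assumes "j \<le> d"
  shows "A j \<in> bose_mesner d A"
proof -
  have "A j = (\<Sum>i\<le>d. if i = j then A j else 0)"
    using assms by simp
  also have "\<dots> = (\<Sum>i\<le>d. cscale (if i = j then 1 else 0) (A i))"
    by (rule sum.cong) (auto simp: vec_eq_iff)
  finally show ?thesis
    using bose_mesnerI by metis
qed

section \<open>Consequences of the scheme axioms\<close>

locale assoc_scheme =
  fixes d :: nat and A :: "nat \<Rightarrow> complex^'v::finite^'v"
  assumes scheme: "association_scheme d A"
begin

lemma class_01: "i \<le> d \<Longrightarrow> A i $ x $ y \<in> {0, 1}"
  and A_0: "A 0 = mat 1"
  and sum_classes: "(\<Sum>i\<le>d. A i) = (\<chi> x y. 1)"
  and class_mult: "i \<le> d \<Longrightarrow> j \<le> d \<Longrightarrow> A i ** A j \<in> bose_mesner d A"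
  using scheme unfolding association_scheme_def by blast+

lemma class_sym: "i \<le> d \<Longrightarrow> A i $ x $ y = A i $ y $ x"
proof -
  assume "i \<le> d"
  hence "transpose (A i) = A i"
    using scheme by (simp add: association_scheme_def)
  hence "transpose (A i) $ y $ x = A i $ y $ x"
    by simp
  thus ?thesis
    by (simp add: transpose_def)
qed

text \<open>Entries 0 or 1 that add up to 1 contain a single 1: the classes partition the pairs of
  vertices.\<close>

lemma ex1_class: "\<exists>!i. i \<le> d \<and> A i $ x $ y = 1"
proof -
  have "(\<Sum>i\<le>d. A i $ x $ y) = 1"
    using arg_cong[OF sum_classes, of "\<lambda>M. M $ x $ y"] by simp
  also have "(\<Sum>i\<le>d. A i $ x $ y) = (\<Sum>i\<le>d. if A i $ x $ y = 1 then 1 else 0)"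
    using class_01 by (intro sum.cong) auto
  also have "\<dots> = of_nat (card {i. i \<le> d \<and> A i $ x $ y = 1})"
    by (simp flip: sum.inter_filter)
  finally have "card {i. i \<le> d \<and> A i $ x $ y = 1} = 1"
    by (metis of_nat_eq_1_iff)
  then obtain j where "{i. i \<le> d \<and> A i $ x $ y = 1} = {j}"
    by (auto simp: card_1_singleton_iff)
  thus ?thesis by (auto simp: set_eq_iff)
qed

lemma class_eq_0: "i \<le> d \<Longrightarrow> j \<le> d \<Longrightarrow> i \<noteq> j \<Longrightarrow> A j $ x $ y = 1 \<Longrightarrow> A i $ x $ y = 0"
  using ex1_class[of x y] class_01[of i x y] by auto

lemma bose_mesner_nth:
  assumes "j \<le> d" "A j $ x $ y = 1"
  shows "(\<Sum>i\<le>d. cscale (c i) (A i)) $ x $ y = c j"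
proof -
  have "(\<Sum>i\<le>d. cscale (c i) (A i)) $ x $ y = (\<Sum>i\<le>d. c i * A i $ x $ y)"
    by simp
  also have "\<dots> = (\<Sum>i\<le>d. if i = j then c j else 0)"
    using assms class_eq_0 by (intro sum.cong) auto
  finally show ?thesis using assms by simp
qed

lemma bose_mesner_mult:
  assumes "M \<in> bose_mesner d A" "N \<in> bose_mesner d A"
  shows "M ** N \<in> bose_mesner d A"
proof -
  obtain c e where "M = (\<Sum>i\<le>d. cscale (c i) (A i))" "N = (\<Sum>i\<le>d. cscale (e i) (A i))"
    using assms by (auto simp: bose_mesner_def)
  thus ?thesis
    by (auto simp: matrix_mult_sum_left matrix_mult_sum_right cscale_mult_left cscale_mult_right
        intro!: bose_mesner_sum bose_mesner_cscale class_mult)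
qed

lemma bose_mesner_cheb_T:
  assumes "M \<in> bose_mesner d A"
  shows "poly_mat (cheb_T m) M \<in> bose_mesner d A"
proof (induction m rule: cheb_T.induct)
  case 1
  show ?case using bose_mesner_class[of 0 d A] by (simp only: poly_mat_cheb_T_0 flip: A_0)
next
  case 2
  show ?case by (simp only: poly_mat_cheb_T_1 assms)
next
  case (3 m)
  thus ?case
    by (simp only: poly_mat_cheb_T_Suc_Suc bose_mesner_diff bose_mesner_cscale bose_mesner_mult
        assms)
qed

text \<open>The row sums of \<open>M\<close> are the diagonal entries of \<open>M ** J\<close>.\<close>

lemma bose_mesner_row_sum:
  assumes "M \<in> bose_mesner d A"
  shows "(\<Sum>z\<in>UNIV. M $ x $ z) = (\<Sum>z\<in>UNIV. M $ y $ z)"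
proof -
  have "M ** (\<Sum>i\<le>d. A i) \<in> bose_mesner d A"
    by (intro bose_mesner_mult assms bose_mesner_sum bose_mesner_class) simp
  then obtain c where c: "M ** (\<Sum>i\<le>d. A i) = (\<Sum>i\<le>d. cscale (c i) (A i))"
    by (auto simp: bose_mesner_def)
  \<comment> \<open>All diagonal pairs lie in class 0, so an element of the algebra has constant
    diagonal.\<close>
  have "(M ** (\<Sum>i\<le>d. A i)) $ z $ z = c 0" for z
    unfolding c by (rule bose_mesner_nth) (simp_all add: A_0 mat_nth)
  thus ?thesis
    by (simp add: sum_classes matrix_mult_nth)
qed

lemma class_row_sum:
  assumes "i \<le> d"
  shows "(\<Sum>y\<in>UNIV. A i $ x $ y) = of_nat (card {y. A i $ x $ y = 1})"
proof -
  have "(\<Sum>y\<in>UNIV. A i $ x $ y) = (\<Sum>y\<in>UNIV. if A i $ x $ y = 1 then 1 else 0)"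
    using class_01[OF assms] by (intro sum.cong) auto
  thus ?thesis by (simp flip: sum.inter_filter)
qed

text \<open>Constant row sums, read as counts of ones, give each class a valency.\<close>

lemma class_card_row:
  assumes "i \<le> d"
  shows "card {z. A i $ x $ z = 1} = card {z. A i $ y $ z = 1}"
  using bose_mesner_row_sum[OF bose_mesner_class, OF assms, of x y]
  by (simp add: class_row_sum[OF assms])

text \<open>Valency one makes the class the graph of a map \<open>p\<close>, symmetry makes
  \<open>p\<close> its own inverse, and disjointness from class 0 excludes fixed points.\<close>

lemma valency_one_class_fpf_involution:
  assumes j: "j \<le> d" "j \<noteq> 0" and row: "card {z. A j $ x $ z = 1} = 1"
  shows "fixed_point_free_involution_matrix (A j)"
proof -
  have "\<exists>!z. A j $ y $ z = 1" for y
    using row class_card_row[OF j(1), of y x] by (auto simp: card_1_singleton_iff set_eq_iff)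
  then obtain p where p: "A j $ y $ z = 1 \<longleftrightarrow> z = p y" for y z
    by metis
  have pp: "p (p y) = y" for y
    using p class_sym[OF j(1)] by metis
  have "p permutes UNIV"
    using pp by (auto simp: permutes_univ) metis+
  \<comment> \<open>The row description z = p y becomes the column convention y = p z because
    \<open>p\<close> is an involution.\<close>
  moreover have A: "A j = (\<chi> y z. if y = p z then 1 else 0)"
    using p pp class_01[OF j(1)] by (auto simp: vec_eq_iff) metis+
  ultimately have perm: "permutation_matrix (A j)"
    by (auto simp: permutation_matrix_def)
  have diag: "A j $ y $ y = 0" for y
    using class_eq_0[of j 0 y y] j by (simp add: A_0 mat_nth)
  have "(A j ** A j) $ y $ z = mat 1 $ y $ z" for y z
  proof -
    have "(A j ** A j) $ y $ z = (\<Sum>k\<in>UNIV. if k = p z then (if y = z then 1 else 0) else 0)"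
      unfolding matrix_mult_nth by (rule sum.cong) (auto simp: A pp)
    thus ?thesis by (simp add: mat_nth)
  qed
  hence "A j ** A j = mat 1" by (simp add: vec_eq_iff)
  moreover have "A j \<noteq> mat 1"
    using diag[of x] by (auto simp: mat_nth)
  ultimately show ?thesis
    using perm diag by (simp add: fixed_point_free_involution_matrix_def)
qed

text \<open>Every class containing some pair has positive valency and hence meets column u, so this
  one column determines all coefficients that matter.\<close>

lemma bose_mesner_unit_column:
  assumes M: "M \<in> bose_mesner d A" and "u \<noteq> v" and "\<gamma> \<noteq> 0"
    and col: "\<And>x. M $ x $ u = (if x = v then \<gamma> else 0)"
  obtains j where "j \<le> d" "j \<noteq> 0" "A j $ u $ v = 1" "card {z. A j $ u $ z = 1} = 1"
    "M = cscale \<gamma> (A j)"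
proof -
  obtain c where c: "M = (\<Sum>i\<le>d. cscale (c i) (A i))"
    using M by (auto simp: bose_mesner_def)
  have entry: "M $ x $ y = c i" if "i \<le> d" "A i $ x $ y = 1" for i x y
    unfolding c using that by (rule bose_mesner_nth)
  obtain j where j: "j \<le> d" "A j $ u $ v = 1"
    using ex1_class by blast
  have j0: "j \<noteq> 0"
    using j(2) \<open>u \<noteq> v\<close> by (intro notI) (simp add: A_0 mat_nth)
  have cj: "c j = \<gamma>"
    using entry[of j v u] j col[of v] class_sym[OF j(1)] by simp
  \<comment> \<open>Each such z carries the nonzero coefficient \<gamma> in column u, whose only
    nonzero entry is in row v.\<close>
  have "z = v" if "A j $ u $ z = 1" for z
    using that entry[of j z u] j(1) col[of z] cj \<open>\<gamma> \<noteq> 0\<close> class_sym[OF j(1), of u z]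
    by (auto split: if_splits)
  hence "{z. A j $ u $ z = 1} = {v}"
    using j(2) by blast
  hence row: "card {z. A j $ u $ z = 1} = 1"
    by simp
  have "M $ x $ y = \<gamma> * A j $ x $ y" for x y
  proof -
    obtain i where i: "i \<le> d" "A i $ x $ y = 1"
      using ex1_class by blast
    show ?thesis
    proof (cases "i = j")
      case True
      thus ?thesis using i entry cj by simp
    next
      case False
      \<comment> \<open>Class i occurs in row x, hence also in row u, at some z other than v; the
        zero entry there forces its coefficient to be 0.\<close>
      have "card {z. A i $ u $ z = 1} \<noteq> 0"
        using i(2) class_card_row[OF i(1), of u x] by auto
      then obtain z where z: "A i $ u $ z = 1"
        by (metis (mono_tags) Collect_empty_eq card.empty)
      hence "z \<noteq> v"
        using class_eq_0[OF i(1) j(1) False j(2)] by auto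
      hence "c i = 0"
        using entry[of i z u] i z col[of z] class_sym[OF i(1)] by simp
      thus ?thesis
        using i entry class_eq_0[OF j(1) i(1), of x y] False by simp
    qed
  qed
  hence "M = cscale \<gamma> (A j)"
    by (simp add: vec_eq_iff)
  thus ?thesis
    using that j j0 row by blast
qed

section \<open>Graphs belonging to the scheme\<close>

lemma belongs_regular:
  assumes "belongs_to_scheme E d A"
  shows "vertex_degree E x = vertex_degree E y"
proof -
  have "(\<Sum>z\<in>UNIV. adjacency_matrix E $ w $ z) = of_nat (vertex_degree E w)" for w
    by (simp add: adjacency_matrix_def vertex_degree_def flip: sum.inter_filter)
  thus ?thesis
    using bose_mesner_row_sum[of "adjacency_matrix E" x y] assms
    by (simp add: belongs_to_scheme_def)
qed

text \<open>By regularity both square roots equal that of the common degree. The reference vertex w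
  makes the scalar independent of the entry.\<close>

lemma discriminant_nth_regular:
  assumes "belongs_to_scheme E d A"
  shows "discriminant E $ x $ y = inverse (of_nat (vertex_degree E w)) * adjacency_matrix E $ x $ y"
  by (simp add: discriminant_nth belongs_regular[OF assms, of x w]
      belongs_regular[OF assms, of y w] field_simps flip: of_real_mult)

lemma discriminant_in_bose_mesner:
  assumes "belongs_to_scheme E d A"
  shows "discriminant E \<in> bose_mesner d A"
proof -
  fix w :: 'v
  have "discriminant E = cscale (inverse (of_nat (vertex_degree E w))) (adjacency_matrix E)"
    by (simp add: vec_eq_iff discriminant_nth_regular[OF assms, of _ _ w])
  thus ?thesis
    using assms by (simp add: belongs_to_scheme_def bose_mesner_cscale)
qed

lemma discriminant_row_sum:
  assumes "belongs_to_scheme E d A" and "no_isolated_vertices E"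
  shows "(\<Sum>y\<in>UNIV. discriminant E $ x $ y) = 1"
proof -
  have "(\<Sum>y\<in>UNIV. adjacency_matrix E $ x $ y) = of_nat (vertex_degree E x)"
    by (simp add: adjacency_matrix_def vertex_degree_def flip: sum.inter_filter)
  thus ?thesis
    using vertex_degree_pos[OF assms(2), of x]
    by (simp add: discriminant_nth_regular[OF assms(1), of _ _ x] flip: sum_distrib_left)
qed

end

theorem theorem3p4:
  fixes A :: "nat \<Rightarrow> complex^'v::finite^'v" and d :: nat
    and E :: "'v set set" and u v :: 'v and \<tau> :: nat
  assumes "association_scheme d A"
    and "simple_graph E" and "no_isolated_vertices E"
    and "belongs_to_scheme E d A"
    and "u \<noteq> v" and "\<tau> > 0"
  shows "perfect_state_transfer E u v \<tau> \<longleftrightarrow>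
    (\<exists>B\<in>A ` {..d}. poly_mat (cheb_T \<tau>) (discriminant E) = B \<and>
       fixed_point_free_involution_matrix B \<and> B $ u $ v = 1)"
proof -
  interpret assoc_scheme d A
    by unfold_locales (rule assms(1))
  let ?N = "boundary_matrix E" and ?M = "adjoint_mat (boundary_matrix E)"
  let ?U = "time_evolution E" and ?T = "poly_mat (cheb_T \<tau>) (discriminant E)"
  show ?thesis
  proof
    assume "perfect_state_transfer E u v \<tau>"
    then obtain \<gamma> where \<gamma>: "cmod \<gamma> = 1"
      and transfer: "mat_power ?U \<tau> *v (?M *v axis u 1) = \<gamma> *s (?M *v axis v 1)"
      by (auto simp: perfect_state_transfer_def vertex_state_def)
    \<comment> \<open>Applying N to the transfer equation turns its left side into column u of
      \<open>?T\<close> and its right side into \<gamma> e_v.\<close>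
    have "?T *v axis u 1 = ?N *v (mat_power ?U \<tau> *v (?M *v axis u 1))"
      by (simp only: matrix_vector_mul_assoc boundary_time_evolution_power[OF assms(3), symmetric]
          matrix_mul_assoc)
    also have "\<dots> = ?N *v (\<gamma> *s (?M *v axis v 1))"
      by (simp only: transfer)
    also have "\<dots> = \<gamma> *s axis v 1"
      by (simp add: vector_scalar_commute matrix_vector_mul_assoc
          boundary_mult_adjoint[OF assms(3)])
    finally have T: "column u ?T = \<gamma> *s axis v 1"
      by (simp add: matrix_mult_axis)
    have col: "?T $ x $ u = (if x = v then \<gamma> else 0)" for x
      using arg_cong[OF T, of "\<lambda>w. w $ x"] by (simp add: column_def axis_def)
    have "?T \<in> bose_mesner d A"
      by (intro bose_mesner_cheb_T discriminant_in_bose_mesner assms(4))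
    moreover have "\<gamma> \<noteq> 0"
      using \<gamma> by auto
    ultimately obtain j where j: "j \<le> d" "j \<noteq> 0" "A j $ u $ v = 1"
        "card {z. A j $ u $ z = 1} = 1" "?T = cscale \<gamma> (A j)"
      using bose_mesner_unit_column[OF _ assms(5) _ col] by metis
    \<comment> \<open>The row sum of \<gamma> A_j is \<gamma>, as the class has valency one;
      comparison with the row sum 1 of \<open>?T\<close> gives the phase.\<close>
    have "1 = (\<Sum>y\<in>UNIV. ?T $ u $ y)"
      by (intro cheb_T_row_sum[symmetric] discriminant_row_sum assms)
    also have "\<dots> = \<gamma>"
      using j by (simp add: class_row_sum flip: sum_distrib_left)
    finally have "?T = A j"
      using j(5) by (simp add: vec_eq_iff)
    thus "\<exists>B\<in>A ` {..d}. ?T = B \<and> fixed_point_free_involution_matrix B \<and> B $ u $ v = 1"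
      using j valency_one_class_fpf_involution[OF j(1,2,4)] by auto
  next
    assume "\<exists>B\<in>A ` {..d}. ?T = B \<and> fixed_point_free_involution_matrix B \<and> B $ u $ v = 1"
    then obtain j where j: "j \<le> d" "?T = A j" "A j $ u $ v = 1"
      and inv: "fixed_point_free_involution_matrix (A j)"
      by auto
    \<comment> \<open>A class matrix is real and symmetric, so the involution property becomes
      unitarity.\<close>
    have "adjoint_mat (A j) = A j"
      using class_01[OF j(1)] class_sym[OF j(1)]
      by (simp add: vec_eq_iff) (metis complex_cnj_one complex_cnj_zero)
    hence "adjoint_mat (A j) ** A j = mat 1"
      using inv by (simp add: fixed_point_free_involution_matrix_def)
    hence "mat_power ?U \<tau> ** ?M = ?M ** A j"
      by (rule time_evolution_power_eq_if_cheb_T[OF assms(3) j(2)])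
    hence "mat_power ?U \<tau> *v (?M *v axis u 1) = ?M *v (A j *v axis u 1)"
      by (simp add: matrix_vector_mul_assoc)
    moreover have "A j *v axis u 1 = axis v 1"
    proof -
      obtain p where p: "p permutes UNIV" "A j = (\<chi> x y. if x = p y then 1 else 0)"
        using inv by (auto simp: fixed_point_free_involution_matrix_def permutation_matrix_def)
      \<comment> \<open>The 1 of column u sits in row p u, while the hypothesis gives the entry at
        (u, v); symmetry of the class connects them.\<close>
      have "v = p u"
        using j(3) class_sym[OF j(1), of u v] by (simp add: p(2) split: if_splits)
      thus ?thesis
        unfolding matrix_mult_axis by (simp add: column_def p(2) vec_eq_iff axis_def)
    qed
    ultimately show "perfect_state_transfer E u v \<tau>"
      using assms(5) unfolding perfect_state_transfer_def vertex_state_def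
      by (intro conjI exI[of _ 1]) simp_all
  qed
qed

end
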